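(* Let $\{\alpha_m\}_{m=1}^N\subset K$. Then the following statements are equivalent: (1) There exists $(\{f_m\}_{m=1}^N,\{g_m\}_{m=1}^N)\in\tilde{S}(\{\alpha_m\}_{m=1}^N)$ which is a pair of dual frames. (2) There exists $(\{f_m\}_{m=1}^N,\{g_m\}_{m=1}^N)\in\tilde{S}(\{\alpha_m\}_{m=1}^N)$ such that $TU^\star$ has only real eigenvalues, $\widetilde{FP}(\{f_m\}_{m=1}^N,\{g_m\}_{m=1}^N)=d$ and $\mathrm{Re}\left(\sum_{m=1}^N\alpha_m\right)\geq d$.
   Context: $K$ is $\mathbb{R}$ or $\mathbb{C}$, and $\mathbb{H}_d$ is a $d$-dimensional Hilbert space over $K$ with inner product $\langle\cdot,\cdot\rangle$ linear in the first argument. For sequences $\{f_m\}_{m=1}^N,\{g_m\}_{m=1}^N$ in $\mathbb{H}_d$, the mixed frame operators are $TU^\star(f)=\sum_{m=1}^N\langle f,g_m\rangle f_m$ and $UT^\star(f)=\sum_{m=1}^N\langle f,f_m\rangle g_m$. The sequences are dual frames if $f=\sum_{m=1}^N\langle f,g_m\rangle f_m$ for all $f\in\mathbb{H}_d$, or $f=\sum_{m=1}^N\langle f,f_m\rangle g_m$ for all $f\in\mathbb{H}_d$ (i.e. $TU^\star=\mathrm{Id}$ or $UT^\star=\mathrm{Id}$). The mixed frame potential is $\widetilde{FP}(\{f_m\}_{m=1}^N,\{g_m\}_{m=1}^N)=\sum_{m=1}^N\sum_{n=1}^N\langle f_m,g_n\rangle\langle f_n,g_m\rangle$. For $\{\alpha_m\}_{m=1}^N\subset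 K$, $\tilde{S}(\{\alpha_m\}_{m=1}^N)=\{(\{f_m\}_{m=1}^N,\{g_m\}_{m=1}^N)\in\mathbb{H}_d^N\times\mathbb{H}_d^N:\langle f_m,g_m\rangle=\alpha_m\ \forall m=1,\dots,N\}$. The eigenvalues of $TU^\star$ are the $d$ complex roots of its characteristic polynomial, counted with multiplicity.
   Formalization: The case N = d ≥ 2 is excluded: there the equivalence is false for some α, e.g. N = d = 2, α = (2,0), f = ((1,0),(0,1)), g = ((2,1),(−1,0)) satisfies (2), while (1) would force every α_m = 1. *)

theory Defs
  imports
    Complex_Main
    "HOL-Computational_Algebra.Fundamental_Theorem_Algebra"
    "Jordan_Normal_Form.Char_Poly"
begin

(* The scalar field K. Up to isomorphism the instances are exactly the real and the complex
   numbers: to_complex is a ring homomorphism between fields, hence injective, and its range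
   is one of these two fields. *)
class real_or_complex = field +
  fixes to_complex :: "'a \<Rightarrow> complex"
  assumes to_complex_add: "to_complex (a + b) = to_complex a + to_complex b"
    and to_complex_mult: "to_complex (a * b) = to_complex a * to_complex b"
    and to_complex_one: "to_complex 1 = 1"
    and range_to_complex: "range to_complex = \<real> \<or> range to_complex = UNIV"

instantiation real :: real_or_complex
begin

definition to_complex_real :: "real \<Rightarrow> complex" where
  "to_complex_real = complex_of_real"

instance
  by standard (auto simp: to_complex_real_def Reals_def)

end

instantiation complex :: real_or_complex
begin

definition to_complex_complex :: "complex \<Rightarrow> complex" where
  "to_complex_complex = (\<lambda>z. z)"

instance
  by standard (auto simp: to_complex_complex_def)

end

(* A d-dimensional inner product space over K, the inner product being linear in the first
   argument. Completeness is automatic in finite dimension. By inner_commute the number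
   inner x x is real, so inner_pos is positive definiteness. *)
locale hilbert_space_dim = vector_space scale
  for scale :: "'k::real_or_complex \<Rightarrow> 'v::ab_group_add \<Rightarrow> 'v" +
  fixes inner :: "'v \<Rightarrow> 'v \<Rightarrow> 'k"
    and d :: nat
  assumes inner_add_left: "inner (x + y) z = inner x z + inner y z"
    and inner_scale_left: "inner (scale a x) y = a * inner x y"
    and inner_commute: "to_complex (inner x y) = cnj (to_complex (inner y x))"
    and inner_pos: "x \<noteq> 0 \<Longrightarrow> 0 < Re (to_complex (inner x x))"
    and basis_card: "\<exists>B. finite B \<and> independent B \<and> span B = UNIV \<and> card B = d"

(* Sequences (f_m) with m = 1, ..., N are functions on nat, of which only the values on
   {1..N} matter. *)

(* T U* for the sequences f (with synthesis operator T) and g (with synthesis operator U). *)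
definition mixed_frame_op ::
  "('k \<Rightarrow> 'v::ab_group_add \<Rightarrow> 'v) \<Rightarrow> ('v \<Rightarrow> 'v \<Rightarrow> 'k) \<Rightarrow> nat \<Rightarrow> (nat \<Rightarrow> 'v) \<Rightarrow> (nat \<Rightarrow> 'v) \<Rightarrow> 'v \<Rightarrow> 'v"
  where "mixed_frame_op scale inner N f g x = (\<Sum>m=1..N. scale (inner x (g m)) (f m))"

definition dual_frames ::
  "('k \<Rightarrow> 'v::ab_group_add \<Rightarrow> 'v) \<Rightarrow> ('v \<Rightarrow> 'v \<Rightarrow> 'k) \<Rightarrow> nat \<Rightarrow> (nat \<Rightarrow> 'v) \<Rightarrow> (nat \<Rightarrow> 'v) \<Rightarrow> bool"
  where "dual_frames scale inner N f g \<longleftrightarrow>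
    (\<forall>x. x = mixed_frame_op scale inner N f g x) \<or> (\<forall>x. x = mixed_frame_op scale inner N g f x)"

definition mixed_frame_potential ::
  "('v \<Rightarrow> 'v \<Rightarrow> 'k::comm_ring_1) \<Rightarrow> nat \<Rightarrow> (nat \<Rightarrow> 'v) \<Rightarrow> (nat \<Rightarrow> 'v) \<Rightarrow> 'k"
  where "mixed_frame_potential inner N f g =
    (\<Sum>m=1..N. \<Sum>n=1..N. inner (f m) (g n) * inner (f n) (g m))"

definition S_tilde ::
  "('v \<Rightarrow> 'v \<Rightarrow> 'k) \<Rightarrow> nat \<Rightarrow> (nat \<Rightarrow> 'k) \<Rightarrow> ((nat \<Rightarrow> 'v) \<times> (nat \<Rightarrow> 'v)) set"
  where "S_tilde inner N \<alpha> = {(f, g). \<forall>m\<in>{1..N}. inner (f m) (g m) = \<alpha> m}"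

definition ordered_basis ::
  "('k::field \<Rightarrow> 'v::ab_group_add \<Rightarrow> 'v) \<Rightarrow> 'v list \<Rightarrow> bool"
  where "ordered_basis scale bs \<longleftrightarrow>
    distinct bs \<and> \<not> module.dependent scale (set bs) \<and> module.span scale (set bs) = UNIV"

definition matrix_of_op ::
  "('k::field \<Rightarrow> 'v::ab_group_add \<Rightarrow> 'v) \<Rightarrow> 'v list \<Rightarrow> ('v \<Rightarrow> 'v) \<Rightarrow> 'k mat"
  where "matrix_of_op scale bs A =
    mat (length bs) (length bs) (\<lambda>(i, j). module.representation scale (set bs) (A (bs ! j)) (bs ! i))"

(* For linear A the choice of the basis does not matter. *)
definition op_char_poly ::
  "('k::field \<Rightarrow> 'v::ab_group_add \<Rightarrow> 'v) \<Rightarrow> ('v \<Rightarrow> 'v) \<Rightarrow> 'k poly"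
  where "op_char_poly scale A =
    char_poly (matrix_of_op scale (SOME bs. ordered_basis scale bs) A)"

(* The complex roots with multiplicity, also when K is the field of real numbers. *)
definition eigenvalues_op ::
  "('k::real_or_complex \<Rightarrow> 'v::ab_group_add \<Rightarrow> 'v) \<Rightarrow> ('v \<Rightarrow> 'v) \<Rightarrow> complex multiset"
  where "eigenvalues_op scale A = proots (map_poly to_complex (op_char_poly scale A))"

end

theory Submission
  imports Defs "Jordan_Normal_Form.Schur_Decomposition"
begin

text \<open>
  Write \<open>S = T U\<^sup>*\<close>. Its trace is \<open>\<Sum>m. \<langle>f m, g m\<rangle>\<close> and the trace of \<open>S\<^sup>2\<close> is the mixed frame
  potential, which gives the forward direction from \<open>S = Id\<close>.
  Conversely, real eigenvalues with sum at least \<open>d\<close> and sum of squares \<open>d\<close> are all \<open>1\<close>. So \<open>S\<close> is injective (though possibly a nontrivial unipotent, so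
  that the given pair need not be dual), whence \<open>d \<le> N\<close> and \<open>\<Sum>m. \<alpha> m = d\<close>. For \<open>d < N\<close> take
  biorthogonal bases \<open>e\<close>, \<open>r\<close> and put \<open>v = \<Sum>i. e i\<close>, \<open>\<langle>x, w\<rangle> = \<Sum>i. (1 - \<alpha> i) \<langle>x, r i\<rangle>\<close>. The pairs
  \<open>(e i, r i - w)\<close> for \<open>i \<le> d\<close> have the required inner products and mixed frame operator
  \<open>x - \<langle>x, w\<rangle> v\<close>; the remaining \<open>f j\<close> are all \<open>v\<close>, and the remaining \<open>g j\<close> have sum \<open>w\<close>.
\<close>

section \<open>Traces and eigenvalues of matrices\<close>

lemma trace_mult_comm:
  fixes A B :: "'a::comm_semiring_0 mat"
  assumes "A \<in> carrier_mat n m" "B \<in> carrier_mat m n"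
  shows "(\<Sum>i<n. (A * B) $$ (i, i)) = (\<Sum>i<m. (B * A) $$ (i, i))"
proof -
  have "(\<Sum>i<n. (A * B) $$ (i, i)) = (\<Sum>i<n. \<Sum>j<m. A $$ (i, j) * B $$ (j, i))"
    using assms by (intro sum.cong) (auto simp: scalar_prod_def atLeast0LessThan)
  also have "\<dots> = (\<Sum>j<m. \<Sum>i<n. B $$ (j, i) * A $$ (i, j))"
    by (subst sum.swap) (simp add: mult.commute)
  also have "\<dots> = (\<Sum>i<m. (B * A) $$ (i, i))"
    using assms by (intro sum.cong) (auto simp: scalar_prod_def atLeast0LessThan)
  finally show ?thesis .
qed

text \<open>By cyclicity of the trace, \<open>Q\<close> moves to the front, where it cancels
  \<open>P\<close>.\<close>

lemma trace_similar:
  fixes A B :: "'a::comm_semiring_1 mat"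
  assumes "A \<in> carrier_mat n n" "B \<in> carrier_mat n n" "P \<in> carrier_mat n n" "Q \<in> carrier_mat n n"
    and "Q * P = 1\<^sub>m n" "A = P * B * Q"
  shows "(\<Sum>i<n. A $$ (i, i)) = (\<Sum>i<n. B $$ (i, i))"
proof -
  have "(\<Sum>i<n. A $$ (i, i)) = (\<Sum>i<n. (Q * (P * B)) $$ (i, i))"
    using assms trace_mult_comm[of "P * B" n n Q] by simp
  also have "Q * (P * B) = B"
    using assms by (metis assoc_mult_mat left_mult_one_mat)
  finally show ?thesis .
qed

text \<open>For \<open>j\<close> different from \<open>i\<close>, one of the positions
  \<open>(i, j)\<close> and \<open>(j, i)\<close> lies below the diagonal, so that term of the
  product vanishes.\<close>

lemma upper_triangular_square_diag:
  fixes B :: "'a::comm_semiring_1 mat"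
  assumes "B \<in> carrier_mat n n" "upper_triangular B" "i < n"
  shows "(B * B) $$ (i, i) = (B $$ (i, i))\<^sup>2"
proof -
  have "(B * B) $$ (i, i) = (\<Sum>j<n. B $$ (i, j) * B $$ (j, i))"
    using assms by (auto simp: scalar_prod_def atLeast0LessThan)
  also have "\<dots> = (\<Sum>j<n. if j = i then (B $$ (i, i))\<^sup>2 else 0)"
  proof (intro sum.cong refl)
    fix j assume "j \<in> {..<n}"
    then show "B $$ (i, j) * B $$ (j, i) = (if j = i then (B $$ (i, i))\<^sup>2 else 0)"
      using assms upper_triangularD[of B i j] upper_triangularD[of B j i]
      by (cases i j rule: linorder_cases) (auto simp: power2_eq_square)
  qed
  also have "\<dots> = (B $$ (i, i))\<^sup>2" using assms by simp
  finally show ?thesis .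
qed

text \<open>Schur decomposition makes \<open>A\<close> similar to a triangular matrix with diagonal
  \<open>es\<close>; the same similarity takes \<open>A * A\<close> to the square of that
  matrix.\<close>

lemma trace_char_poly_roots:
  fixes A :: "complex mat"
  assumes A: "A \<in> carrier_mat n n" and es: "char_poly A = (\<Prod>a\<leftarrow>es. [:- a, 1:])"
  shows "(\<Sum>i<n. A $$ (i, i)) = sum_list es"
    and "(\<Sum>i<n. (A * A) $$ (i, i)) = (\<Sum>a\<leftarrow>es. a\<^sup>2)"
    and "length es = n"
proof -
  obtain B P Q where schur: "schur_decomposition A es = (B, P, Q)"
    by (cases "schur_decomposition A es") auto
  note s = schur_decomposition[OF A es schur]
  then have sim: "similar_mat_wit A B P Q" and ut: "upper_triangular B" and dg: "diag_mat B = es"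
    by auto
  note w = similar_mat_witD2[OF A sim]
  have es_eq: "es = map (\<lambda>i. B $$ (i, i)) [0..<n]"
    using dg w by (auto simp: diag_mat_def)
  show "length es = n" by (simp add: es_eq)
  show "(\<Sum>i<n. A $$ (i, i)) = sum_list es"
    using trace_similar[OF w(4,5,6,7,2,3)]
    by (simp add: es_eq interv_sum_list_conv_sum_set_nat atLeast0LessThan)
  have "P * B * Q * (P * B * Q) = P * B * (Q * P) * B * Q"
    using w(5-7) by (simp add: assoc_mult_mat[of _ n n _ n _ n])
  also have "\<dots> = P * (B * B) * Q"
    using w(5-7) unfolding w(2) by (simp add: assoc_mult_mat[of _ n n _ n _ n])
  finally have "A * A = P * (B * B) * Q" using w(3) by simp
  then have "(\<Sum>i<n. (A * A) $$ (i, i)) = (\<Sum>i<n. (B * B) $$ (i, i))"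
    using w by (intro trace_similar[of _ n _ P Q]) auto
  also have "\<dots> = (\<Sum>i<n. (B $$ (i, i))\<^sup>2)"
    by (intro sum.cong) (auto simp: upper_triangular_square_diag[OF w(5) ut])
  finally show "(\<Sum>i<n. (A * A) $$ (i, i)) = (\<Sum>a\<leftarrow>es. a\<^sup>2)"
    by (simp add: es_eq interv_sum_list_conv_sum_set_nat atLeast0LessThan o_def)
qed

text \<open>Expanding the squares of \<open>x - 1\<close> bounds their sum by
  \<open>n - 2 * n + n = 0\<close>, where \<open>n\<close> is the length, so each of them
  vanishes.\<close>

lemma all_eq_1_if_sum_squares_le:
  fixes xs :: "real list"
  assumes "(\<Sum>x\<leftarrow>xs. x\<^sup>2) \<le> length xs" "length xs \<le> sum_list xs"
  shows "\<forall>x\<in>set xs. x = 1"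
proof -
  have "(\<Sum>x\<leftarrow>xs. (x - 1)\<^sup>2) = (\<Sum>x\<leftarrow>xs. x\<^sup>2) - 2 * sum_list xs + length xs"
    by (induction xs) (auto simp: power2_eq_square algebra_simps)
  then have "(\<Sum>x\<leftarrow>xs. (x - 1)\<^sup>2) \<le> 0" using assms by simp
  then have "(\<Sum>x\<leftarrow>xs. (x - 1)\<^sup>2) = 0"
    by (intro antisym sum_list_nonneg) auto
  then have "\<forall>y\<in>set (map (\<lambda>x. (x - 1)\<^sup>2) xs). y = 0"
    by (subst (asm) sum_list_nonneg_eq_0_iff) auto
  then show ?thesis by auto
qed

section \<open>The scalar field inside the complex numbers\<close>

interpretation to_complex: field_hom "to_complex :: 'k::real_or_complex \<Rightarrow> complex"
proof
  show "to_complex (0::'k) = 0"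
    using to_complex_add[of "0::'k" 0] by simp
qed (simp_all add: to_complex_add to_complex_mult to_complex_one)

text \<open>Conjugation pulled back along \<open>to_complex\<close>, whose injectivity makes the
  choice unique.\<close>

definition conj_scalar :: "'k::real_or_complex \<Rightarrow> 'k" where
  "conj_scalar a = (SOME b. to_complex b = cnj (to_complex a))"

text \<open>Both possible ranges of \<open>to_complex\<close> are closed under conjugation, which
  fixes the reals pointwise.\<close>

lemma to_complex_conj_scalar: "to_complex (conj_scalar a) = cnj (to_complex a)"
proof -
  have "cnj (to_complex a) \<in> range (to_complex :: 'a \<Rightarrow> complex)"
    using range_to_complex
  proof
    assume R: "range (to_complex :: 'a \<Rightarrow> complex) = \<real>"
    then have "to_complex a \<in> \<real>" by blast
    then show ?thesis using R by (simp add: Reals_cnj_iff)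
  qed simp
  then have "\<exists>b::'a. to_complex b = cnj (to_complex a)" by (metis rangeE)
  then show ?thesis unfolding conj_scalar_def by (rule someI_ex)
qed

section \<open>Inner products and mixed frame operators\<close>

context hilbert_space_dim
begin

lemma inner_add_right: "inner x (y + z) = inner x y + inner x z"
proof -
  \<comment> \<open>Since \<open>to_complex\<close> is injective, the identity can be checked in the
    complex numbers, where \<open>inner_commute\<close> is available.\<close>
  have "to_complex (inner x (y + z)) = to_complex (inner x y + inner x z)"
    by (simp add: inner_commute[of x] inner_add_left hom_distribs)
  then show ?thesis by simp
qed

lemma inner_scale_right: "inner x (scale a y) = conj_scalar a * inner x y"
proof -
  have "to_complex (inner x (scale a y)) = to_complex (conj_scalar a * inner x y)"
    by (simp add: inner_commute[of x] inner_scale_left hom_distribs to_complex_conj_scalar)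
  then show ?thesis by simp
qed

lemma inner_scale_conj_right: "inner x (scale (conj_scalar a) y) = a * inner x y"
proof -
  have "to_complex (conj_scalar (conj_scalar a)) = to_complex a"
    by (simp only: to_complex_conj_scalar complex_cnj_cnj)
  then show ?thesis by (simp add: inner_scale_right)
qed

lemma inner_zero_left [simp]: "inner 0 y = 0"
  using inner_scale_left[of 0 0 y] by simp

lemma inner_zero_right [simp]: "inner x 0 = 0"
  using inner_add_right[of x 0 0] by (metis add.right_neutral add_left_cancel)

lemma inner_diff_right: "inner x (y - z) = inner x y - inner x z"
  using inner_add_right[of x "y - z" z] by simp

lemma inner_sum_left: "inner (sum h A) y = (\<Sum>a\<in>A. inner (h a) y)"
  by (induction A rule: infinite_finite_induct) (simp_all add: inner_add_left)

lemma inner_sum_right: "inner x (sum h A) = (\<Sum>a\<in>A. inner x (h a))"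
  by (induction A rule: infinite_finite_induct) (simp_all add: inner_add_right)

text \<open>Otherwise \<open>y - z\<close> would be a nonzero vector orthogonal to itself.\<close>

lemma eq_if_inner_eq:
  assumes "\<And>x. inner x y = inner x z"
  shows "y = z"
proof (rule ccontr)
  assume "y \<noteq> z"
  then have "0 < Re (to_complex (inner (y - z) (y - z)))" by (intro inner_pos) simp
  then show False using assms by (simp add: inner_diff_right)
qed

abbreviation mixed :: "nat \<Rightarrow> (nat \<Rightarrow> 'v) \<Rightarrow> (nat \<Rightarrow> 'v) \<Rightarrow> 'v \<Rightarrow> 'v" where
  "mixed \<equiv> mixed_frame_op scale inner"

lemma linear_mixed: "Vector_Spaces.linear scale scale (mixed N f g)"
  by unfold_locales
    (simp_all add: mixed_frame_op_def inner_add_left inner_scale_left scale_left_distrib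
      sum.distrib scale_sum_right)

lemma inner_mixed_adjoint: "inner (mixed N f g x) y = inner x (mixed N g f y)"
proof -
  have conj: "conj_scalar (inner y z) = inner z y" for y z
  proof -
    have "to_complex (conj_scalar (inner y z)) = to_complex (inner z y)"
      using inner_commute[of z y] by (simp add: to_complex_conj_scalar)
    then show ?thesis by simp
  qed
  show ?thesis
    by (simp add: mixed_frame_op_def inner_sum_left inner_sum_right inner_scale_left
        inner_scale_right conj mult.commute)
qed

text \<open>Exchanging \<open>f\<close> and \<open>g\<close> gives the adjoint, and an operator with
  identity adjoint is the identity; so the two alternatives coincide.\<close>

lemma dual_frames_iff: "dual_frames scale inner N f g \<longleftrightarrow> (\<forall>x. mixed N f g x = x)"
proof -
  have "mixed N f g x = x" if "\<forall>x. x = mixed N g f x" for f g x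
    by (rule eq_if_inner_eq) (metis inner_mixed_adjoint that)
  then show ?thesis unfolding dual_frames_def by (metis (no_types, lifting))
qed

text \<open>In this form, one trace formula serves for the operator and for its square.\<close>

lemma mixed_mixed: "mixed N f g (mixed N f g x) = mixed N (\<lambda>m. mixed N f g (f m)) g x"
proof -
  interpret l: Vector_Spaces.linear scale scale "mixed N f g" by (rule linear_mixed)
  have "mixed N f g (\<Sum>m=1..N. scale (inner x (g m)) (f m))
      = (\<Sum>m=1..N. scale (inner x (g m)) (mixed N f g (f m)))"
    by (simp add: l.sum l.scale)
  then show ?thesis by (simp add: mixed_frame_op_def)
qed

text \<open>The sum over \<open>n\<close> is the operator applied to \<open>f m\<close>. With
  \<open>mixed_mixed\<close>, this identifies the potential as the trace of the square.\<close>

lemma mixed_frame_potential_eq: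
  "mixed_frame_potential inner N f g = (\<Sum>m=1..N. inner (mixed N f g (f m)) (g m))"
  by (simp add: mixed_frame_potential_def mixed_frame_op_def inner_sum_left inner_scale_left)

section \<open>Coordinates and matrices with respect to a basis\<close>

lemma ordered_basis_exists: "\<exists>bs. ordered_basis scale bs"
proof -
  obtain B where "finite B" "independent B" "span B = UNIV" using basis_card by auto
  then show ?thesis unfolding ordered_basis_def by (metis finite_distinct_list)
qed

context
  fixes bs
  assumes bs: "ordered_basis scale bs"
begin

abbreviation coord :: "'v \<Rightarrow> 'v \<Rightarrow> 'k" where
  "coord \<equiv> representation (set bs)"

lemma independent_bs: "independent (set bs)" and span_bs: "span (set bs) = UNIV"
  and distinct_bs: "distinct bs"
  using bs by (auto simp: ordered_basis_def)

lemma length_bs: "length bs = d"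
proof -
  obtain B where "finite B" "independent B" "span B = UNIV" "card B = d" using basis_card by auto
  then have "card (set bs) = d"
    using dim_eq_card[of "set bs" UNIV] dim_eq_card[of B UNIV] independent_bs span_bs by simp
  then show ?thesis using distinct_card[OF distinct_bs] by simp
qed

lemma sum_bs: "(\<Sum>b\<in>set bs. h b) = (\<Sum>i<d. h (bs ! i))"
  using sum.reindex_bij_betw[OF bij_betw_nth[OF distinct_bs refl refl], of h]
  by (simp add: length_bs)

lemma sum_coord: "(\<Sum>i<d. scale (coord x (bs ! i)) (bs ! i)) = x"
  using sum_representation_eq[OF independent_bs, of x "set bs"]
  by (simp add: span_bs sum_bs)

lemma coord_linear:
  assumes "Vector_Spaces.linear scale scale S"
  shows "coord (S x) b = (\<Sum>k<d. coord (S (bs ! k)) b * coord x (bs ! k))"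
proof -
  interpret l: Vector_Spaces.linear scale scale S by fact
  have "coord (S x) b = coord (S (\<Sum>k<d. scale (coord x (bs ! k)) (bs ! k))) b"
    by (simp add: sum_coord)
  also have "\<dots> = coord (\<Sum>k<d. scale (coord x (bs ! k)) (S (bs ! k))) b"
    by (simp add: l.sum l.scale)
  also have "\<dots> = (\<Sum>k<d. coord (S (bs ! k)) b * coord x (bs ! k))"
    by (simp add: representation_sum representation_scale independent_bs span_bs mult.commute)
  finally show ?thesis .
qed

lemma matrix_of_op_carrier: "matrix_of_op scale bs S \<in> carrier_mat d d"
  by (simp add: matrix_of_op_def length_bs)

lemma matrix_of_op_index:
  "i < d \<Longrightarrow> j < d \<Longrightarrow> matrix_of_op scale bs S $$ (i, j) = coord (S (bs ! j)) (bs ! i)"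
  by (simp add: matrix_of_op_def length_bs)

lemma matrix_of_op_comp:
  assumes "Vector_Spaces.linear scale scale S"
  shows "matrix_of_op scale bs S * matrix_of_op scale bs T = matrix_of_op scale bs (\<lambda>x. S (T x))"
proof (rule eq_matI)
  fix i j assume "i < dim_row (matrix_of_op scale bs (\<lambda>x. S (T x)))"
    "j < dim_col (matrix_of_op scale bs (\<lambda>x. S (T x)))"
  then have ij: "i < d" "j < d" by (simp_all add: matrix_of_op_def length_bs)
  then show "(matrix_of_op scale bs S * matrix_of_op scale bs T) $$ (i, j)
      = matrix_of_op scale bs (\<lambda>x. S (T x)) $$ (i, j)"
    using matrix_of_op_carrier[of S] matrix_of_op_carrier[of T]
    by (simp add: matrix_of_op_index scalar_prod_def coord_linear[OF assms, of "T (bs ! j)"]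
        atLeast0LessThan)
qed (simp_all add: matrix_of_op_def)

lemma matrix_of_op_id: "(\<And>x. S x = x) \<Longrightarrow> matrix_of_op scale bs S = 1\<^sub>m d"
  using distinct_bs
  by (auto simp: matrix_of_op_def length_bs representation_basis independent_bs nth_eq_iff_index_eq)

text \<open>The operator is a sum of rank-one maps; after exchanging the sums, the coordinates of
  \<open>f m\<close> reassemble to \<open>f m\<close> inside the inner product, for any
  basis.\<close>

lemma trace_matrix_of_mixed:
  "(\<Sum>i<d. matrix_of_op scale bs (mixed N f g) $$ (i, i)) = (\<Sum>m=1..N. inner (f m) (g m))"
proof -
  have "(\<Sum>i<d. matrix_of_op scale bs (mixed N f g) $$ (i, i))
      = (\<Sum>i<d. \<Sum>m=1..N. inner (bs ! i) (g m) * coord (f m) (bs ! i))"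
    by (intro sum.cong)
      (simp_all add: matrix_of_op_index mixed_frame_op_def representation_sum
        representation_scale independent_bs span_bs)
  also have "\<dots> = (\<Sum>m=1..N. inner (\<Sum>i<d. scale (coord (f m) (bs ! i)) (bs ! i)) (g m))"
    by (subst sum.swap) (simp add: inner_sum_left inner_scale_left mult.commute)
  finally show ?thesis by (simp add: sum_coord)
qed

lemma trace_matrix_of_mixed_square:
  "(\<Sum>i<d. (matrix_of_op scale bs (mixed N f g) * matrix_of_op scale bs (mixed N f g)) $$ (i, i))
    = mixed_frame_potential inner N f g"
  by (simp only: matrix_of_op_comp[OF linear_mixed] mixed_mixed trace_matrix_of_mixed
      mixed_frame_potential_eq)

text \<open>The coordinate vector of a nonzero kernel element is an eigenvector for 0.\<close>

lemma char_poly_0_if_not_inj: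
  assumes S: "Vector_Spaces.linear scale scale S" and "\<not> inj S"
  shows "poly (char_poly (matrix_of_op scale bs S)) 0 = 0"
proof -
  interpret l: Vector_Spaces.linear scale scale S by fact
  obtain x where x: "S x = 0" "x \<noteq> 0" using assms(2) l.inj_iff_eq_0 by auto
  define v where "v = vec d (\<lambda>i. coord x (bs ! i))"
  have "matrix_of_op scale bs S *\<^sub>v v = 0\<^sub>v d"
    using matrix_of_op_carrier[of S] coord_linear[OF S, of x] x
    by (intro eq_vecI)
      (auto simp: v_def scalar_prod_def matrix_of_op_index atLeast0LessThan representation_zero)
  moreover have "v \<noteq> 0\<^sub>v d"
  proof
    assume v0: "v = 0\<^sub>v d"
    have "coord x (bs ! i) = 0" if "i < d" for i
      using arg_cong[OF v0, of "\<lambda>v. v $ i"] that by (simp add: v_def)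
    then show False using sum_coord[of x] x by simp
  qed
  ultimately have "eigenvalue (matrix_of_op scale bs S) 0"
    using matrix_of_op_carrier[of S] unfolding eigenvalue_def eigenvector_def
    by (intro exI[of _ v]) (auto simp: v_def)
  then show ?thesis using eigenvalue_root_char_poly[OF matrix_of_op_carrier] by blast
qed

text \<open>Riesz representation of the coordinate functionals: a dual pair already expresses every
  linear functional through the vectors \<open>g m\<close>, so no orthonormal basis is needed.\<close>

lemma coord_eq_inner:
  assumes "\<And>x. mixed N u g x = x"
  shows "\<exists>y. \<forall>x. coord x b = inner x y"
proof (intro exI allI)
  fix x
  have "coord x b = coord (mixed N u g x) b" by (simp add: assms)
  then show "coord x b = inner x (\<Sum>m=1..N. scale (conj_scalar (coord (u m) b)) (g m))"
    by (simp add: mixed_frame_op_def representation_sum representation_scale independent_bs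
        span_bs inner_sum_right inner_scale_conj_right mult.commute)
qed

end

section \<open>Construction of a dual pair with prescribed diagonal\<close>

lemma biorthogonal_basis:
  assumes "\<And>x. mixed N u g x = x"
  obtains e r where "\<And>x. mixed d e r x = x"
    and "\<And>i j. i \<in> {1..d} \<Longrightarrow> j \<in> {1..d} \<Longrightarrow> inner (e i) (r j) = (if i = j then 1 else 0)"
proof -
  obtain bs where bs: "ordered_basis scale bs" using ordered_basis_exists by blast
  obtain y where y: "\<And>b x. representation (set bs) x b = inner x (y b)"
    using coord_eq_inner[OF bs assms] by metis
  \<comment> \<open>Lists count from 0, frame sequences from 1.\<close>
  define e where "e i = bs ! (i - 1)" for i
  have "mixed d e (\<lambda>i. y (e i)) x = x" for x
    using sum_coord[OF bs, of x] sum.atLeast1_atMost_eq[of "\<lambda>i. scale (inner x (y (e i))) (e i)" d]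
    by (simp add: mixed_frame_op_def y e_def)
  moreover have "inner (e i) (y (e j)) = (if i = j then 1 else 0)"
    if "i \<in> {1..d}" "j \<in> {1..d}" for i j
    using that length_bs[OF bs] distinct_bs[OF bs]
    by (auto simp: e_def y[symmetric] representation_basis independent_bs[OF bs]
        nth_eq_iff_index_eq)
  ultimately show ?thesis using that by blast
qed

lemma dual_frames_prescribed_diagonal:
  assumes "\<And>x. mixed d e r x = x"
    and er: "\<And>i j. i \<in> {1..d} \<Longrightarrow> j \<in> {1..d} \<Longrightarrow> inner (e i) (r j) = (if i = j then 1 else 0)"
    and "0 < d" "d < N" and \<alpha>: "(\<Sum>m=1..N. \<alpha> m) = of_nat d"
  shows "\<exists>(f, g)\<in>S_tilde inner N \<alpha>. dual_frames scale inner N f g"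
proof -
  define v where "v = (\<Sum>i=1..d. e i)"
  \<comment> \<open>The scalars are conjugated because \<open>inner\<close> is conjugate linear in
    its second argument.\<close>
  define w where "w = (\<Sum>i=1..d. scale (conj_scalar (1 - \<alpha> i)) (r i))"
  \<comment> \<open>As \<open>inner v (r 1) = 1\<close>, this choice gives
    \<open>inner v (t j) = \<alpha> j\<close>.\<close>
  define t where "t j = scale (conj_scalar (\<alpha> j)) (r 1)" for j
  define f where "f m = (if m \<le> d then e m else v)" for m
  \<comment> \<open>Index \<open>d + 1\<close>, available since \<open>d < N\<close>, absorbs the
    remainder so that the \<open>g m\<close> beyond \<open>d\<close> sum to
    \<open>w\<close>.\<close>
  define g where "g m = (if m \<le> d then r m - w else if m = d + 1 then w - (\<Sum>j=d+2..N. t j) else t m)"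
    for m
  have split: "(\<Sum>m=1..N. h m) = (\<Sum>m=1..d. h m) + (h (d + 1) + (\<Sum>m=d+2..N. h m))"
    for h :: "nat \<Rightarrow> 'c::comm_monoid_add"
  proof -
    have "{1..N} = {1..d} \<union> ({d+1} \<union> {d+2..N})" using \<open>d < N\<close> by auto
    then show ?thesis by (simp add: sum.union_disjoint add.left_commute)
  qed
  have inner_w: "inner x w = (\<Sum>i=1..d. (1 - \<alpha> i) * inner x (r i))" for x
    by (simp add: w_def inner_sum_right inner_scale_conj_right)
  have e_w: "inner (e i) w = 1 - \<alpha> i" if "i \<in> {1..d}" for i
    using that by (simp add: inner_w er if_distrib cong: if_cong)
  have v_r: "inner v (r 1) = 1"
    using \<open>0 < d\<close> by (simp add: v_def inner_sum_left er)
  have v_t: "inner v (t j) = \<alpha> j" for j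
    by (simp add: t_def inner_scale_conj_right v_r del: One_nat_def)
  have "inner v w = of_nat d - (\<Sum>i=1..d. \<alpha> i)"
    by (simp add: v_def inner_sum_left e_w sum_subtractf)
  \<comment> \<open>Here the condition on the sum of the \<open>\<alpha> m\<close> enters; it makes
    the inner product at index \<open>d + 1\<close> come out right.\<close>
  then have v_w: "inner v w = \<alpha> (d + 1) + (\<Sum>m=d+2..N. \<alpha> m)"
    using \<alpha> split[of \<alpha>] by (simp add: algebra_simps)
  have "inner (f m) (g m) = \<alpha> m" if "m \<in> {1..N}" for m
    using that by (auto simp: f_def g_def inner_diff_right er e_w v_t v_w inner_sum_right)
  moreover have "mixed N f g x = x" for x
  proof -
    have "mixed N f g x = (\<Sum>m=1..d. scale (inner x (r m) - inner x w) (e m))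
        + (scale (inner x (w - (\<Sum>j=d+2..N. t j))) v + (\<Sum>m=d+2..N. scale (inner x (t m)) v))"
      unfolding mixed_frame_op_def split by (simp add: f_def g_def inner_diff_right)
    also have "(\<Sum>m=1..d. scale (inner x (r m) - inner x w) (e m)) = x - scale (inner x w) v"
      using assms(1)[of x]
      by (simp add: mixed_frame_op_def scale_left_diff_distrib sum_subtractf v_def scale_sum_right)
    \<comment> \<open>Beyond \<open>d\<close> every \<open>f m\<close> is \<open>v\<close>, so only
      the sum of the \<open>g m\<close> matters; this restores the term lost in the first
      \<open>d\<close> summands.\<close>
    also have "scale (inner x (w - (\<Sum>j=d+2..N. t j))) v + (\<Sum>m=d+2..N. scale (inner x (t m)) v)
        = scale (inner x w) v"
      by (simp add: inner_diff_right inner_sum_right scale_sum_left[symmetric]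
          scale_left_distrib[symmetric])
    finally show ?thesis by simp
  qed
  ultimately show ?thesis
    by (intro bexI[of _ "(f, g)"]) (auto simp: S_tilde_def dual_frames_iff)
qed

section \<open>Eigenvalues of operators\<close>

lemma op_char_poly_basis_exists:
  "\<exists>bs. ordered_basis scale bs
    \<and> (\<forall>S. op_char_poly scale S = char_poly (matrix_of_op scale bs S))"
  using someI_ex[OF ordered_basis_exists] unfolding op_char_poly_def by blast

lemma eigenvalues_op_char_poly:
  assumes "ordered_basis scale bs" "op_char_poly scale S = char_poly (matrix_of_op scale bs S)"
  shows "eigenvalues_op scale S = proots (char_poly (map_mat to_complex (matrix_of_op scale bs S)))"
  using assms to_complex.char_poly_hom[OF matrix_of_op_carrier] by (simp add: eigenvalues_op_def)

text \<open>A characteristic polynomial is monic, hence nonzero, so \<open>proots\<close> contains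
  exactly its roots.\<close>

lemma set_eigenvalues_op:
  assumes bs: "ordered_basis scale bs"
    and cp: "op_char_poly scale S = char_poly (matrix_of_op scale bs S)"
  shows "set_mset (eigenvalues_op scale S)
    = {z. poly (char_poly (map_mat to_complex (matrix_of_op scale bs S))) z = 0}"
proof -
  have "char_poly (map_mat to_complex (matrix_of_op scale bs S)) \<noteq> 0"
    using degree_monic_char_poly[of "map_mat to_complex (matrix_of_op scale bs S)" d]
      matrix_of_op_carrier[OF bs, of S] by auto
  then show ?thesis by (simp add: eigenvalues_op_char_poly[OF assms])
qed

lemma eigenvalues_op_id:
  assumes "\<And>x. S x = x" "z \<in># eigenvalues_op scale S"
  shows "z = 1"
proof -
  obtain bs where bs: "ordered_basis scale bs"
    and cp: "\<And>S. op_char_poly scale S = char_poly (matrix_of_op scale bs S)"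
    using op_char_poly_basis_exists by blast
  have "map_mat to_complex (matrix_of_op scale bs S) = (1\<^sub>m d :: complex mat)"
    by (simp add: matrix_of_op_id[OF bs assms(1)] to_complex.mat_hom_one)
  then have "poly (char_poly (1\<^sub>m d)) z = 0"
    using assms(2) set_eigenvalues_op[OF bs cp, of S] by auto
  then have "eigenvalue (1\<^sub>m d) z" by (simp add: eigenvalue_root_char_poly[of _ d])
  then obtain u where u: "u \<in> carrier_vec d" "u \<noteq> 0\<^sub>v d" "u = z \<cdot>\<^sub>v u"
    by (auto simp: eigenvalue_def eigenvector_def)
  then obtain i where i: "i < d" "u $ i \<noteq> 0" by (metis carrier_vecD eq_vecI index_zero_vec)
  then have "(z \<cdot>\<^sub>v u) $ i = z * u $ i" using u(1) by simp
  then have "u $ i = z * u $ i" by (simp only: u(3)[symmetric])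
  then show ?thesis using i by (metis mult_cancel_right1)
qed

text \<open>Trace and potential are the sum and the sum of squares of the eigenvalues. All
  eigenvalues are therefore 1, which excludes a kernel and sharpens the bound on the trace to an
  equality.\<close>

lemma mixed_inj_and_trace:
  assumes real: "\<And>z. z \<in># eigenvalues_op scale (mixed N f g) \<Longrightarrow> z \<in> \<real>"
    and fp: "mixed_frame_potential inner N f g = of_nat d"
    and ge: "Re (to_complex (\<Sum>m=1..N. inner (f m) (g m))) \<ge> real d"
  shows "inj (mixed N f g)" and "(\<Sum>m=1..N. inner (f m) (g m)) = of_nat d"
proof -
  obtain bs where bs: "ordered_basis scale bs"
    and cp: "\<And>S. op_char_poly scale S = char_poly (matrix_of_op scale bs S)"
    using op_char_poly_basis_exists by blast
  define M where "M = matrix_of_op scale bs (mixed N f g)"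
  define C where "C = map_mat to_complex M"
  have M: "M \<in> carrier_mat d d" using matrix_of_op_carrier[OF bs] by (simp add: M_def)
  then have C: "C \<in> carrier_mat d d" by (simp add: C_def)
  obtain es where es: "char_poly C = (\<Prod>a\<leftarrow>es. [:- a, 1:])"
    using char_poly_factorized[OF C] by blast
  note tr = trace_char_poly_roots[OF C es]
  have tr1: "to_complex (\<Sum>m=1..N. inner (f m) (g m)) = sum_list es"
    unfolding trace_matrix_of_mixed[OF bs, symmetric] tr(1)[symmetric]
    using M by (simp add: C_def M_def[symmetric] hom_distribs)
  have "C * C = map_mat to_complex (M * M)"
    unfolding C_def using to_complex.mat_hom_mult[OF M M] by simp
  then have tr2: "(\<Sum>a\<leftarrow>es. a\<^sup>2) = of_nat d"
    using M fp unfolding trace_matrix_of_mixed_square[OF bs, symmetric] M_def[symmetric] tr(2)[symmetric]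
    by (simp add: hom_distribs flip: to_complex.hom_sum)
  have root: "set es = set_mset (eigenvalues_op scale (mixed N f g))"
    unfolding set_eigenvalues_op[OF bs cp] M_def[symmetric] C_def[symmetric] es
    by (auto simp: poly_prod_list prod_list_zero_iff)
  \<comment> \<open>The eigenvalues being real, nothing is lost by passing to a list of reals, where
    sums of squares can be estimated.\<close>
  define xs where "xs = map Re es"
  have "\<And>a. a \<in> set es \<Longrightarrow> complex_of_real (Re a) = a" using real root by (simp add: of_real_Re)
  then have es_xs: "es = map of_real xs" by (simp add: xs_def map_idI)
  have "complex_of_real (\<Sum>x\<leftarrow>xs. x\<^sup>2) = of_nat d"
    unfolding tr2[symmetric] es_xs by (induction xs) auto
  then have sq: "(\<Sum>x\<leftarrow>xs. x\<^sup>2) = d" by (metis of_real_eq_iff of_real_of_nat_eq)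
  have sm: "complex_of_real (sum_list xs) = sum_list es"
    unfolding es_xs by (induction xs) auto
  then have "sum_list xs \<ge> d" using ge unfolding tr1 by (metis Re_complex_of_real)
  moreover have len: "length xs = d" using tr(3) by (simp add: xs_def)
  ultimately have xs1: "\<forall>x\<in>set xs. x = 1" using sq by (intro all_eq_1_if_sum_squares_le) auto
  then have "xs = replicate d 1" using len by (metis replicate_length_same)
  then have "sum_list es = to_complex (of_nat d :: 'k)"
    using sm by (simp add: sum_list_replicate hom_distribs)
  then have "to_complex (\<Sum>m=1..N. inner (f m) (g m)) = to_complex (of_nat d :: 'k)"
    using tr1 by simp
  then show "(\<Sum>m=1..N. inner (f m) (g m)) = of_nat d"
    by (rule to_complex.injectivity)
  show "inj (mixed N f g)"
  proof (rule ccontr)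
    assume "\<not> inj (mixed N f g)"
    then have "poly (char_poly M) 0 = 0"
      unfolding M_def by (rule char_poly_0_if_not_inj[OF bs linear_mixed])
    then have "poly (char_poly C) 0 = 0"
      unfolding C_def to_complex.char_poly_hom[OF M] by (simp add: poly_0_coeff_0 coeff_map_poly)
    then have "0 \<in> set es" unfolding es by (auto simp: poly_prod_list prod_list_zero_iff)
    then show False using xs1 es_xs by auto
  qed
qed

end

section \<open>The equivalence\<close>

theorem corollary1:
  fixes scale :: "'k::real_or_complex \<Rightarrow> 'v::ab_group_add \<Rightarrow> 'v"
    and inner :: "'v \<Rightarrow> 'v \<Rightarrow> 'k"
    and d N :: nat
    and \<alpha> :: "nat \<Rightarrow> 'k"
  assumes "hilbert_space_dim scale inner d"
    and "N \<noteq> d \<or> d \<le> 1"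
  shows "(\<exists>(f, g)\<in>S_tilde inner N \<alpha>. dual_frames scale inner N f g) \<longleftrightarrow>
    (\<exists>(f, g)\<in>S_tilde inner N \<alpha>.
      (\<forall>z \<in># eigenvalues_op scale (mixed_frame_op scale inner N f g). z \<in> \<real>) \<and>
      mixed_frame_potential inner N f g = of_nat d \<and>
      Re (to_complex (\<Sum>m=1..N. \<alpha> m)) \<ge> real d)"
    (is "?dual \<longleftrightarrow> ?spec")
proof -
  interpret hilbert_space_dim scale inner d by fact
  show ?thesis
  proof
    assume ?dual
    then obtain f g where fg: "(f, g) \<in> S_tilde inner N \<alpha>" and id: "\<And>x. mixed N f g x = x"
      by (auto simp: dual_frames_iff)
    then have \<alpha>: "\<And>m. m \<in> {1..N} \<Longrightarrow> inner (f m) (g m) = \<alpha> m"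
      by (auto simp: S_tilde_def)
    obtain bs where bs: "ordered_basis scale bs" using ordered_basis_exists by blast
    \<comment> \<open>The trace of the identity, computed in two ways.\<close>
    have "(\<Sum>m=1..N. \<alpha> m) = (\<Sum>i<d. (1\<^sub>m d :: 'k mat) $$ (i, i))"
      using trace_matrix_of_mixed[OF bs, of N f g] by (simp add: matrix_of_op_id[OF bs id] \<alpha>)
    then have sum: "(\<Sum>m=1..N. \<alpha> m) = of_nat d" by simp
    have "mixed_frame_potential inner N f g = of_nat d"
      using sum by (simp add: mixed_frame_potential_eq id \<alpha>)
    moreover have "\<forall>z \<in># eigenvalues_op scale (mixed N f g). z \<in> \<real>"
      using eigenvalues_op_id[of "mixed N f g"] id by force
    ultimately show ?spec
      using fg sum by (intro bexI[of _ "(f, g)"]) (simp_all add: hom_distribs)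
  next
    assume ?spec
    then obtain f g where fg: "(f, g) \<in> S_tilde inner N \<alpha>"
      and real: "\<And>z. z \<in># eigenvalues_op scale (mixed N f g) \<Longrightarrow> z \<in> \<real>"
      and fp: "mixed_frame_potential inner N f g = of_nat d"
      and ge: "Re (to_complex (\<Sum>m=1..N. \<alpha> m)) \<ge> real d"
      by auto
    have \<alpha>: "\<And>m. m \<in> {1..N} \<Longrightarrow> inner (f m) (g m) = \<alpha> m"
      using fg by (auto simp: S_tilde_def)
    then have sum_eq: "(\<Sum>m=1..N. inner (f m) (g m)) = (\<Sum>m=1..N. \<alpha> m)" by simp
    have inj: "inj (mixed N f g)" and sum: "(\<Sum>m=1..N. \<alpha> m) = of_nat d"
      using mixed_inj_and_trace[OF real fp] ge unfolding sum_eq by auto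
    interpret vector_space_pair scale scale ..
    \<comment> \<open>Composing with a left inverse turns the given pair into a dual pair
      \<open>R (f m)\<close>, \<open>g m\<close>, whose diagonal may differ from
      \<open>\<alpha>\<close>.\<close>
    obtain R where R: "Vector_Spaces.linear scale scale R" and RS: "\<And>x. R (mixed N f g x) = x"
      using linear_injective_left_inverse[OF linear_mixed inj] by (auto simp: fun_eq_iff)
    interpret R: Vector_Spaces.linear scale scale R by (rule R)
    have id: "mixed N (\<lambda>m. R (f m)) g x = x" for x
      using RS[of x] by (simp add: mixed_frame_op_def R.sum R.scale)
    \<comment> \<open>By the reconstruction formula the \<open>N\<close> vectors
      \<open>R (f m)\<close> span the space, whence \<open>d \<le> N\<close>.\<close>
    have in_span: "x \<in> span ((\<lambda>m. R (f m)) ` {1..N})" for x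
      by (subst id[symmetric], unfold mixed_frame_op_def)
        (intro span_sum span_scale span_base imageI)
    obtain B where B: "finite B" "independent B" "span B = UNIV" "card B = d"
      using basis_card by auto
    have "card B \<le> card ((\<lambda>m. R (f m)) ` {1..N})"
      using B in_span by (intro conjunct2[OF independent_span_bound]) auto
    also have "\<dots> \<le> N" using card_image_le[of "{1..N}"] by force
    finally have "d \<le> N" using B by simp
    \<comment> \<open>For \<open>N = d \<ge> 2\<close> the equivalence fails: dual pairs are then
      biorthogonal, so every \<open>\<alpha> m\<close> is 1, whereas for \<open>d = 2\<close> the
      unipotent matrix with rows (0, 1) and (-1, 2) realizes the diagonal (0, 2).\<close>
    then consider "d = 0" | "d = 1" "N = 1" | "0 < d" "d < N" using assms(2) by linarith
    then show ?dual
    proof cases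
      case 1
      then have "(UNIV :: 'v set) = {0}" using B by simp
      then have "mixed N f g x = x" for x by (metis UNIV_I singletonD)
      then show ?thesis using fg by (auto simp: dual_frames_iff)
    next
      case 2
      \<comment> \<open>With a single vector the trace is the only diagonal entry. It equals 1, so
        \<open>R\<close> fixes \<open>f 1\<close> and the given pair is already dual.\<close>
      then have "inner (f 1) (g 1) = 1" using \<alpha> sum by simp
      then have "R (f 1) = f 1" using id[of "f 1"] by (simp add: mixed_frame_op_def 2)
      then have "mixed N f g x = x" for x using id[of x] by (simp add: mixed_frame_op_def 2)
      then show ?thesis using fg by (auto simp: dual_frames_iff)
    next
      case 3
      \<comment> \<open>The pair \<open>R (f m)\<close>, \<open>g m\<close> only serves to supply a
        biorthogonal basis; the final pair is built anew.\<close>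
      obtain e r where "\<And>x. mixed d e r x = x"
        "\<And>i j. i \<in> {1..d} \<Longrightarrow> j \<in> {1..d} \<Longrightarrow> inner (e i) (r j) = (if i = j then 1 else 0)"
        using biorthogonal_basis[OF id] by metis
      then show ?thesis using dual_frames_prescribed_diagonal 3 sum by blast
    qed
  qed
qed

end
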